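(* Let $n\ge 5$ be an integer. Then $$Ar(P_{n,2},C_6)=\begin{cases} 11, & \text{if } n=5;\\ 14, & \text{if } n=6;\\ 17, & \text{if } n=7;\\ 34, & \text{if } n=12;\\ 3n, & \text{otherwise.} \end{cases}$$
   Context: For integers $n\ge 3$ and $1\le k\le \lfloor \frac{n-1}{2}\rfloor$, the generalized Petersen graph $P_{n,k}$ is the simple graph with vertex set $\{u_i,v_i : 0\leq i\leq n-1\}$ ($2n$ distinct vertices) and edge set $\{u_iu_{i+1},\,u_iv_i,\,v_iv_{i+k} : 0\leq i\leq n-1\}$, subscripts taken modulo $n$; it has $3n$ edges. $C_d$ denotes the cycle on $d$ vertices. An edge-coloring of a graph $G$ is an arbitrary map from $E(G)$ to a set of colors (not necessarily proper); the number of colors of the coloring is the number of colors actually used. A copy of $H$ in $G$ is a (not necessarily induced) subgraph of $G$ isomorphic to $H$; it is rainbow if its edges receive pairwise distinct colors. The anti-Ramsey number $Ar(G,H)$ is the maximum number of colors in an edge-coloring of $G$ which has no rainbow copy of $H$; if $G$ contains no copy of $H$, then $Ar(G,H)=|E(G)|$. *)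

theory Defs
  imports Main
begin

(* An undirected graph is a pair of a vertex set and a set of two-element vertex sets. *)
type_synonym 'v graph = "'v set \<times> 'v set set"

abbreviation verts :: "'v graph \<Rightarrow> 'v set" where "verts \<equiv> fst"
abbreviation edges :: "'v graph \<Rightarrow> 'v set set" where "edges \<equiv> snd"

definition simple_graph :: "'v graph \<Rightarrow> bool" where
  "simple_graph G \<longleftrightarrow> finite (verts G) \<and> (\<forall>e\<in>edges G. e \<subseteq> verts G \<and> card e = 2)"

definition subgraph :: "'v graph \<Rightarrow> 'v graph \<Rightarrow> bool" where
  "subgraph K G \<longleftrightarrow> simple_graph K \<and> verts K \<subseteq> verts G \<and> edges K \<subseteq> edges G"

definition isomorphic :: "'v graph \<Rightarrow> 'w graph \<Rightarrow> bool" where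
  "isomorphic G H \<longleftrightarrow> (\<exists>f. bij_betw f (verts G) (verts H) \<and>
     (\<forall>x\<in>verts G. \<forall>y\<in>verts G. {x, y} \<in> edges G \<longleftrightarrow> {f x, f y} \<in> edges H))"

definition copy_in :: "'v graph \<Rightarrow> 'w graph \<Rightarrow> 'v graph \<Rightarrow> bool" where
  "copy_in K H G \<longleftrightarrow> subgraph K G \<and> isomorphic K H"

definition rainbow :: "('v set \<Rightarrow> 'c) \<Rightarrow> 'v graph \<Rightarrow> bool" where
  "rainbow c K \<longleftrightarrow> inj_on c (edges K)"

definition no_rainbow_copy :: "('v set \<Rightarrow> 'c) \<Rightarrow> 'v graph \<Rightarrow> 'w graph \<Rightarrow> bool" where
  "no_rainbow_copy c G H \<longleftrightarrow> (\<forall>K. copy_in K H G \<longrightarrow> \<not> rainbow c K)"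

(* Natural numbers suffice as colors, since edge sets are finite. The set of color counts is
   finite for finite G; it is nonempty (so that Max is meaningful) whenever H has at least
   two edges, as the constant coloring then has no rainbow copy of H. *)
definition anti_ramsey :: "'v graph \<Rightarrow> 'w graph \<Rightarrow> nat" where
  "anti_ramsey G H =
     Max {card (c ` edges G) | c :: 'v set \<Rightarrow> nat. no_rainbow_copy c G H}"

(* The convention for graphs without a copy of H is a consequence of the definition. *)
lemma anti_ramsey_no_copy:
  assumes fin: "finite (edges G)" and none: "\<And>K. \<not> copy_in K H G"
  shows "anti_ramsey G H = card (edges G)"
  unfolding anti_ramsey_def
proof (rule Max_eqI)
  have bound: "card (c ` edges G) \<le> card (edges G)" for c :: "'a set \<Rightarrow> nat"
    using fin by (rule card_image_le)
  show "finite {card (c ` edges G) | c :: 'a set \<Rightarrow> nat. no_rainbow_copy c G H}"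
    by (rule finite_subset[of _ "{..card (edges G)}"]) (use bound in auto)
  show "y \<le> card (edges G)"
    if "y \<in> {card (c ` edges G) | c :: 'a set \<Rightarrow> nat. no_rainbow_copy c G H}" for y
    using that bound by auto
  obtain c :: "'a set \<Rightarrow> nat" where "inj_on c (edges G)"
    using fin finite_imp_inj_to_nat_seg by blast
  then have "card (edges G) = card (c ` edges G)"
    by (simp add: card_image)
  moreover have "no_rainbow_copy c G H"
    using none by (simp add: no_rainbow_copy_def)
  ultimately show
    "card (edges G) \<in> {card (c ` edges G) | c :: 'a set \<Rightarrow> nat. no_rainbow_copy c G H}"
    by blast
qed

(* The cycle on d vertices, for d at least 3. *)
definition cycle_graph :: "nat \<Rightarrow> nat graph" where
  "cycle_graph d = ({0..<d}, {{i, (i + 1) mod d} | i. i < d})"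

datatype petersen_vertex = U nat | V nat

(* The generalized Petersen graph, for n at least 3 and 1 \<le> k \<le> (n - 1) div 2. *)
definition gen_petersen :: "nat \<Rightarrow> nat \<Rightarrow> petersen_vertex graph" where
  "gen_petersen n k =
     (U ` {0..<n} \<union> V ` {0..<n},
      {{U i, U ((i + 1) mod n)} | i. i < n} \<union>
      {{U i, V i} | i. i < n} \<union>
      {{V i, V ((i + k) mod n)} | i. i < n})"

end

theory Submission
  imports Defs
begin

text \<open>
Write \<open>a\<^sub>i\<close>, \<open>s\<^sub>i\<close>, \<open>b\<^sub>i\<close> for the outer edge \<open>u\<^sub>iu\<^sub>i\<^sub>+\<^sub>1\<close>, the spoke \<open>u\<^sub>iv\<^sub>i\<close> and the inner edge \<open>v\<^sub>iv\<^sub>i\<^sub>+\<^sub>2\<close>, and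
call a 6-cycle a hexagon.

Which hexagons are there? Unroll the graph along the integers: a hexagon becomes a walk of six moves,
each of which changes the position by \<open>\<plusminus>1\<close> (outer edge) or \<open>\<plusminus>2\<close> (inner edge), or is a spoke. The walk
never backtracks and closes up modulo \<open>n\<close>. Two spokes are never consecutive and their number is
even, so there are none or two. Without spokes the total displacement is \<open>\<plusminus>6\<close> or \<open>\<plusminus>12\<close>; with two
spokes there are \<open>k\<close> outer moves in one direction and \<open>4 - k\<close> inner moves in one direction,
\<open>1 \<le> k \<le> 3\<close>, and the displacement is \<open>\<plusminus>k \<plusminus> 2(4 - k)\<close>. Hence its absolute value is 1, 2, 5, 6, 7 or 12. As \<open>n\<close> divides
it, a hexagon exists only for \<open>n = 5, 6, 7, 12\<close> (lemma \<open>no_hexagons\<close>), and for all other \<open>n\<close> every edge can get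
its own colour. In the four exceptional cases a finite check lists the hexagons: ten for \<open>n = 5\<close>, seven
for \<open>n = 6\<close> and \<open>n = 7\<close>, and for \<open>n = 12\<close> the two disjoint cycles formed by the inner edges.

Upper bounds. For \<open>n = 12\<close> each of the two disjoint hexagons costs one colour. For
\<open>n = 5, 6, 7\<close> four colours are lost, by double counting (lemma \<open>colour_loss_at_least_4\<close>). Two
distinct edges lie in at most two common hexagons, and an edge lies in at most \<open>D\<close> hexagons, where \<open>D = 4\<close> for \<open>n = 5\<close>
and \<open>D = 3\<close> for \<open>n = 6, 7\<close>. A colour class with \<open>m\<close> edges repeats its colour in at most
\<open>m D / 2\<close> hexagons, and in at most two if \<open>m = 2\<close>. If at most three colours are lost, the
classes of size above one have sizes 4, or 3 and 2, or 3, or are at most three pairs; so at most \<open>2 D\<close> hexagons have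
a repeated colour (for sizes 3 and 2 with \<open>D = 3\<close>, round \<open>9 / 2 + 2\<close> down), which is less than their number.

Lower bounds. Four colourings are enough; they are given in the definition of \<open>colouring\<close>.
\<close>

section \<open>Cycles as lists of vertices\<close>

definition cycle_edges :: "'v list \<Rightarrow> 'v set set" where
  "cycle_edges xs = (\<lambda>j. {xs ! j, xs ! ((j + 1) mod length xs)}) ` {..<length xs}"

definition cycle_in :: "'v graph \<Rightarrow> 'v list \<Rightarrow> bool" where
  "cycle_in G xs \<longleftrightarrow> distinct xs \<and> set xs \<subseteq> verts G \<and> cycle_edges xs \<subseteq> edges G"

lemma pair_in_cycle_edges_iff:
  assumes "distinct xs" "length xs = d" "i < d" "j < d"
  shows "{xs ! i, xs ! j} \<in> cycle_edges xs \<longleftrightarrow> {i, j} \<in> edges (cycle_graph d)"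
proof -
  have "{xs ! i, xs ! j} = {xs ! k, xs ! ((k + 1) mod d)} \<longleftrightarrow> {i, j} = {k, (k + 1) mod d}"
    if "k < d" for k
  proof -
    have "(k + 1) mod d < d"
      using that by (intro mod_less_divisor) auto
    with that assms show ?thesis
      by (simp add: doubleton_eq_iff nth_eq_iff_index_eq)
  qed
  with assms show ?thesis
    by (auto simp: cycle_edges_def cycle_graph_def)
qed

lemma cycle_in_imp_copy:
  assumes "cycle_in G xs" "length xs = d" "d \<ge> 2"
  shows "copy_in (set xs, cycle_edges xs) (cycle_graph d) G"
proof -
  have dist: "distinct xs"
    using assms by (simp add: cycle_in_def)
  have edge: "e \<subseteq> set xs \<and> card e = 2" if e: "e \<in> cycle_edges xs" for e
  proof -
    obtain j where j: "j < d" "e = {xs ! j, xs ! ((j + 1) mod d)}"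
      using e assms by (auto simp: cycle_edges_def)
    have "(j + 1) mod d < d" "(j + 1) mod d \<noteq> j"
      using j assms by (auto simp: mod_if)
    then show ?thesis
      using j dist assms by (auto simp: nth_eq_iff_index_eq)
  qed
  have bij: "bij_betw ((!) xs) {0..<d} (set xs)"
    using dist assms by (simp add: bij_betw_nth atLeast0LessThan)
  let ?f = "inv_into {0..<d} ((!) xs)"
  have iso: "isomorphic (set xs, cycle_edges xs) (cycle_graph d)"
    unfolding isomorphic_def
  proof (intro exI conjI ballI)
    show "bij_betw ?f (verts (set xs, cycle_edges xs)) (verts (cycle_graph d))"
      using bij_betw_inv_into[OF bij] by (simp add: cycle_graph_def)
    fix x y assume "x \<in> verts (set xs, cycle_edges xs)" "y \<in> verts (set xs, cycle_edges xs)"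
    then obtain i j where ij: "i < d" "j < d" "x = xs ! i" "y = xs ! j"
      using assms by (auto simp: in_set_conv_nth)
    then have "?f x = i" "?f y = j"
      using bij_betw_inv_into_left[OF bij] by auto
    then show "{x, y} \<in> edges (set xs, cycle_edges xs) \<longleftrightarrow> {?f x, ?f y} \<in> edges (cycle_graph d)"
      using pair_in_cycle_edges_iff[OF dist] ij assms by simp
  qed
  with edge assms show ?thesis
    by (auto simp: copy_in_def subgraph_def simple_graph_def cycle_in_def)
qed

lemma copy_imp_cycle_in:
  assumes "copy_in K (cycle_graph d) G"
  obtains xs where "length xs = d" "cycle_in G xs" "cycle_edges xs = edges K"
proof -
  have K: "simple_graph K" "verts K \<subseteq> verts G" "edges K \<subseteq> edges G"
    using assms by (auto simp: copy_in_def subgraph_def)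
  obtain f where f: "bij_betw f (verts K) {0..<d}"
    and adj: "\<And>x y. x \<in> verts K \<Longrightarrow> y \<in> verts K \<Longrightarrow>
      {x, y} \<in> edges K \<longleftrightarrow> {f x, f y} \<in> edges (cycle_graph d)"
    using assms by (auto simp: copy_in_def isomorphic_def cycle_graph_def)
  define xs where "xs = map (inv_into (verts K) f) [0..<d]"
  have g: "bij_betw (inv_into (verts K) f) {0..<d} (verts K)"
    using bij_betw_inv_into[OF f] .
  have len: "length xs = d" and set: "set xs = verts K" and dist: "distinct xs"
    using g by (auto simp: xs_def bij_betw_def distinct_map)
  have fx: "f (xs ! i) = i" if "i < d" for i
    using that bij_betw_inv_into_right[OF f] by (simp add: xs_def)
  have iff: "{xs ! i, xs ! j} \<in> cycle_edges xs \<longleftrightarrow> {xs ! i, xs ! j} \<in> edges K"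
    if "i < d" "j < d" for i j
    using that adj[of "xs ! i" "xs ! j"] pair_in_cycle_edges_iff[OF dist len that] len
    by (simp add: fx flip: set)
  have "cycle_edges xs = edges K"
  proof (intro equalityI subsetI)
    fix e assume e: "e \<in> cycle_edges xs"
    then obtain j where j: "j < d" "e = {xs ! j, xs ! ((j + 1) mod d)}"
      using len by (auto simp: cycle_edges_def)
    then have "(j + 1) mod d < d"
      by (intro mod_less_divisor) auto
    with j e show "e \<in> edges K"
      using iff[of j "(j + 1) mod d"] by simp
  next
    fix e assume e: "e \<in> edges K"
    then obtain x y where xy: "e = {x, y}" "x \<in> verts K" "y \<in> verts K"
      using K by (fastforce simp: simple_graph_def card_2_iff)
    then obtain i j where "i < d" "j < d" "x = xs ! i" "y = xs ! j"
      using len by (auto simp: in_set_conv_nth simp flip: set)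
    with e xy iff show "e \<in> cycle_edges xs"
      by simp
  qed
  with that len dist set K show thesis
    by (auto simp: cycle_in_def)
qed

text \<open>Copies of a cycle are traced by vertex lists and conversely, so rainbow copies can be discussed
  without isomorphisms.\<close>

lemma no_rainbow_cycle_iff:
  assumes "d \<ge> 2"
  shows "no_rainbow_copy c G (cycle_graph d) \<longleftrightarrow>
    (\<forall>xs. length xs = d \<and> cycle_in G xs \<longrightarrow> \<not> inj_on c (cycle_edges xs))"
proof
  assume L: "no_rainbow_copy c G (cycle_graph d)"
  show "\<forall>xs. length xs = d \<and> cycle_in G xs \<longrightarrow> \<not> inj_on c (cycle_edges xs)"
    using L cycle_in_imp_copy[OF _ _ assms]
    by (fastforce simp: no_rainbow_copy_def rainbow_def)
next
  assume R: "\<forall>xs. length xs = d \<and> cycle_in G xs \<longrightarrow> \<not> inj_on c (cycle_edges xs)"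
  show "no_rainbow_copy c G (cycle_graph d)"
    unfolding no_rainbow_copy_def rainbow_def
  proof (intro allI impI)
    fix K assume "copy_in K (cycle_graph d) G"
    then show "\<not> inj_on c (edges K)"
      using R by (metis copy_imp_cycle_in)
  qed
qed

section \<open>Names for the edges\<close>

text \<open>Edges are two-element sets of vertices, on which the finite checks below would be cumbersome.
  For \<open>n \<ge> 5\<close> an edge is determined by its kind and its first index, and such names are easy to
  compute with.\<close>

datatype edge_name = Outer nat | Spoke nat | Inner nat

fun edge :: "nat \<Rightarrow> edge_name \<Rightarrow> petersen_vertex set" where
  "edge n (Outer i) = {U i, U ((i + 1) mod n)}"
| "edge n (Spoke i) = {U i, V i}"
| "edge n (Inner i) = {V i, V ((i + 2) mod n)}"

definition names :: "nat \<Rightarrow> edge_name list" where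
  "names n = map Outer [0..<n] @ map Spoke [0..<n] @ map Inner [0..<n]"

lemma card_names: "card (set (names n)) = 3 * n"
  by (subst distinct_card) (auto simp: names_def distinct_map inj_on_def)

lemma edges_gen_petersen: "edges (gen_petersen n 2) = edge n ` set (names n)"
proof -
  have "edges (gen_petersen n 2) =
    (edge n \<circ> Outer) ` {..<n} \<union> (edge n \<circ> Spoke) ` {..<n} \<union> (edge n \<circ> Inner) ` {..<n}"
    by (auto simp: gen_petersen_def)
  then show ?thesis
    by (simp add: names_def image_Un image_comp atLeast0LessThan Un_assoc)
qed

text \<open>The only possible clash is that \<open>{i, i + k}\<close> and \<open>{j, j + k}\<close> agree with the roles of the
  two ends exchanged; then \<open>n\<close> divides \<open>2 k \<le> 4\<close>.\<close>

lemma inj_on_edge: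
  assumes "n \<ge> 5"
  shows "inj_on (edge n) (set (names n))"
proof -
  have pair: "i = j"
    if k: "0 < k" "k \<le> 2" and ij: "i < n" "j < n" "{i, (i + k) mod n} = {j, (j + k) mod n}" for i j k
  proof (rule ccontr)
    assume "i \<noteq> j"
    then have "(i + k) mod n = j" "(j + k) mod n = i"
      using ij by (metis doubleton_eq_iff)+
    then have "(j + k + k) mod n = j"
      by (metis mod_add_left_eq)
    moreover have "(j + k + k) mod n = (if j + k + k < n then j + k + k else j + k + k - n)"
      using k ij assms by (auto simp: mod_if)
    ultimately show False
      using k assms by (simp split: if_splits)
  qed
  have image: "edge n (Outer i) = U ` {i, (i + 1) mod n}" "edge n (Inner i) = V ` {i, (i + 2) mod n}" for i
    by auto
  have "inj U" "inj V"
    by (simp_all add: inj_on_def)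
  then have same: "i = j"
    if "edge n (Outer i) = edge n (Outer j) \<or> edge n (Inner i) = edge n (Inner j)" "i < n" "j < n" for i j
    using that pair[of 1 i j] pair[of 2 i j] unfolding image
    by (simp add: inj_image_eq_iff del: image_insert) blast
  have "e = f" if eq: "edge n e = edge n f" and "e \<in> set (names n)" "f \<in> set (names n)" for e f
  proof (cases "\<exists>i j. e = Outer i \<and> f = Outer j \<or> e = Inner i \<and> f = Inner j")
    case True
    then obtain i j where "e = Outer i \<and> f = Outer j \<or> e = Inner i \<and> f = Inner j"
      by blast
    moreover from this have "i < n" "j < n"
      using that by (auto simp: names_def)
    ultimately show ?thesis
      using eq same[of i j] by metis
  next
    case False
    then show ?thesis
      using eq by (cases e; cases f) (simp_all add: doubleton_eq_iff)
  qed
  then show ?thesis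
    by (auto simp: inj_on_def)
qed

definition hexagons :: "nat \<Rightarrow> edge_name set set" where
  "hexagons n = {E. E \<subseteq> set (names n) \<and>
     (\<exists>xs. length xs = 6 \<and> cycle_in (gen_petersen n 2) xs \<and> cycle_edges xs = edge n ` E)}"

lemma no_rainbow_hexagon_iff:
  assumes "n \<ge> 5"
  shows "no_rainbow_copy c (gen_petersen n 2) (cycle_graph 6) \<longleftrightarrow>
    (\<forall>E\<in>hexagons n. \<not> inj_on (c \<circ> edge n) E)"
proof -
  have "inj_on (c \<circ> edge n) E \<longleftrightarrow> inj_on c (edge n ` E)" if "E \<subseteq> set (names n)" for E
    using that inj_on_edge[OF assms] by (metis comp_inj_on_iff inj_on_subset)
  moreover have "\<exists>E. E \<subseteq> set (names n) \<and> cycle_edges xs = edge n ` E"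
    if "cycle_in (gen_petersen n 2) xs" for xs
    using that by (auto simp: cycle_in_def edges_gen_petersen subset_image_iff)
  ultimately show ?thesis
    unfolding no_rainbow_cycle_iff[of 6, simplified] hexagons_def
    by (smt (verit, best) mem_Collect_eq)
qed

text \<open>An optimal colouring is conveniently given by choosing a representative in each colour
  class, that is, as a map from names to names.\<close>

lemma anti_ramsey_hexagon_eqI:
  fixes r :: "edge_name \<Rightarrow> edge_name"
  assumes n: "n \<ge> 5"
    and lower: "\<And>E. E \<in> hexagons n \<Longrightarrow> \<not> inj_on r E"
    and card: "card (r ` set (names n)) = m"
    and upper: "\<And>\<kappa> :: edge_name \<Rightarrow> nat. (\<And>E. E \<in> hexagons n \<Longrightarrow> \<not> inj_on \<kappa> E) \<Longrightarrow>
      card (\<kappa> ` set (names n)) \<le> m"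
  shows "anti_ramsey (gen_petersen n 2) (cycle_graph 6) = m"
  unfolding anti_ramsey_def
proof (rule Max_eqI)
  let ?G = "gen_petersen n 2"
  let ?A = "{card (c ` edges ?G) | c :: petersen_vertex set \<Rightarrow> nat. no_rainbow_copy c ?G (cycle_graph 6)}"
  show le: "y \<le> m" if "y \<in> ?A" for y
  proof -
    obtain c :: "petersen_vertex set \<Rightarrow> nat" where c: "y = card (c ` edges ?G)"
      "no_rainbow_copy c ?G (cycle_graph 6)"
      using \<open>y \<in> ?A\<close> by blast
    have "card ((c \<circ> edge n) ` set (names n)) \<le> m"
      by (rule upper) (use c no_rainbow_hexagon_iff[OF n] in blast)
    then show ?thesis
      by (simp add: c(1) edges_gen_petersen image_comp)
  qed
  then show "finite ?A"
    by (meson finite_nat_set_iff_bounded_le)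
  obtain g :: "edge_name \<Rightarrow> nat" where g: "inj_on g (r ` set (names n))"
    using finite_imp_inj_to_nat_seg[of "r ` set (names n)"] by auto
  define c where "c = g \<circ> r \<circ> inv_into (set (names n)) (edge n)"
  have c: "c (edge n e) = g (r e)" if "e \<in> set (names n)" for e
    using that inj_on_edge[OF n] by (simp add: c_def)
  have "\<not> inj_on (c \<circ> edge n) E" if E: "E \<in> hexagons n" for E
  proof -
    have sub: "E \<subseteq> set (names n)"
      using E by (auto simp: hexagons_def)
    have "inj_on (c \<circ> edge n) E \<longleftrightarrow> inj_on (g \<circ> r) E"
      by (rule inj_on_cong) (use sub c in auto)
    then show ?thesis
      using lower[OF E] by (auto dest: inj_on_imageI2)
  qed
  then have "no_rainbow_copy c ?G (cycle_graph 6)"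
    by (simp add: no_rainbow_hexagon_iff[OF n])
  moreover have "card (c ` edges ?G) = m"
  proof -
    have "c ` edges ?G = g ` r ` set (names n)"
      using c by (simp add: edges_gen_petersen image_image)
    then show ?thesis
      using card_image[OF g] card by simp
  qed
  ultimately show "m \<in> ?A"
    by blast
qed

section \<open>Lifting hexagons to walks on the integer line\<close>

text \<open>A state \<open>(t, p)\<close> is a vertex of the unrolled graph: \<open>t\<close> tells whether it is an outer vertex, and
  \<open>p\<close> is its position on the integer line. A move is coded by \<open>-1\<close> or \<open>1\<close> for a
  step along an outer or inner edge and by \<open>0\<close> for a spoke, so that the move opposite to \<open>s\<close> is \<open>- s\<close>.\<close>

fun move :: "bool \<times> int \<Rightarrow> int \<Rightarrow> bool \<times> int" where
  "move (t, p) s = (if s = 0 then (\<not> t, p) else (t, p + (if t then s else 2 * s)))"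

fun proj :: "nat \<Rightarrow> bool \<times> int \<Rightarrow> petersen_vertex" where
  "proj n (t, p) = (if t then U else V) (nat (p mod int n))"

text \<open>An outer or inner edge is named after the lower one of its two ends on the line.\<close>

fun move_name :: "nat \<Rightarrow> bool \<times> int \<Rightarrow> int \<Rightarrow> edge_name" where
  "move_name n (t, p) s =
    (if s = 0 then Spoke (nat (p mod int n))
     else if t then Outer (nat (min p (p + s) mod int n))
     else Inner (nat (min p (p + 2 * s) mod int n)))"

text \<open>The final state of a walk is left out, because in a hexagon it projects to the initial
  one.\<close>

fun walk_ends :: "bool \<times> int \<Rightarrow> int list \<Rightarrow> (bool \<times> int) list" where
  "walk_ends z [] = []"
| "walk_ends z (s # ss) = z # walk_ends (move z s) ss"

fun walk_names :: "nat \<Rightarrow> bool \<times> int \<Rightarrow> int list \<Rightarrow> edge_name list" where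
  "walk_names n z [] = []"
| "walk_names n z (s # ss) = move_name n z s # walk_names n (move z s) ss"

definition hexagon_walk :: "nat \<Rightarrow> bool \<times> int \<Rightarrow> int list \<Rightarrow> bool" where
  "hexagon_walk n z ss \<longleftrightarrow> length ss = 6 \<and> set ss \<subseteq> {-1, 0, 1} \<and>
     proj n (foldl move z ss) = proj n z \<and> distinct (map (proj n) (walk_ends z ss))"

lemma nat_mod_add:
  assumes "n > 0"
  shows "nat ((p + int k) mod int n) = (nat (p mod int n) + k) mod n"
proof -
  have "int (nat ((p + int k) mod int n)) = int ((nat (p mod int n) + k) mod n)"
    using assms by (simp add: of_nat_mod mod_add_left_eq)
  then show ?thesis
    by (simp only: of_nat_eq_iff)
qed

lemma edge_move_name:
  assumes "n > 0" "s \<in> {-1, 0, 1}"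
  shows "edge n (move_name n z s) = {proj n z, proj n (move z s)}"
proof -
  obtain t p where z: "z = (t, p)"
    by (cases z)
  have shift: "nat ((p + 1) mod int n) = (nat (p mod int n) + 1) mod n"
    "nat ((p + 2) mod int n) = (nat (p mod int n) + 2) mod n" for p
    using nat_mod_add[OF assms(1), of p 1] nat_mod_add[OF assms(1), of p 2] by simp_all
  consider "s = 0" | "s = 1" | "s = -1"
    using assms by blast
  then show ?thesis
  proof cases
    case 3
    then show ?thesis
      using shift(1)[of "p - 1"] shift(2)[of "p - 2"] by (simp add: z min_def insert_commute)
  qed (auto simp add: z min_def shift)
qed

lemma move_name_in_names:
  assumes "n > 0"
  shows "move_name n z s \<in> set (names n)"
  using assms by (cases z) (auto simp: names_def nat_less_iff)

lemma neighbour_is_move: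
  assumes n: "n > 0" and e: "{proj n z, y} \<in> edges (gen_petersen n 2)"
  obtains s where "s \<in> {-1, 0, 1}" "y = proj n (move z s)"
proof -
  obtain t p where z: "z = (t, p)"
    by (cases z)
  define i where "i = nat (p mod int n)"
  have i: "i < n" "nat ((p + 1) mod int n) = (i + 1) mod n" "nat ((p + 2) mod int n) = (i + 2) mod n"
    using n nat_mod_add[OF n, of p 1] nat_mod_add[OF n, of p 2] by (auto simp: i_def nat_less_iff)
  have prev: "j = nat ((p - int k) mod int n)" if "i = (j + k) mod n" "j < n" for j k
  proof -
    have "p mod int n = (int j + int k) mod int n"
      using that n by (simp add: i_def nat_eq_iff of_nat_mod)
    then have "(p - int k) mod int n = int j mod int n"
      by (metis add_diff_cancel_right' mod_diff_left_eq)
    with that show ?thesis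
      by simp
  qed
  have "y \<in> {proj n (move z (-1)), proj n (move z 0), proj n (move z 1)}"
    using e i prev[of _ 1] prev[of _ 2]
    by (cases t) (auto simp: gen_petersen_def z doubleton_eq_iff simp flip: i_def)
  with that show thesis
    by auto
qed

lemma move_back: "s \<in> {-1, 0, 1} \<Longrightarrow> move (move z s) (- s) = z"
  by (cases z) auto

lemma proj_move_cong:
  assumes "proj n z = proj n z'" "n > 0"
  shows "proj n (move z s) = proj n (move z' s)"
proof -
  obtain t p t' p' where z: "z = (t, p)" "z' = (t', p')"
    by (cases z, cases z')
  have "t = t'" "p mod int n = p' mod int n"
    using assms by (auto simp: z eq_nat_nat_iff split: if_splits)
  moreover from this have "(p + a) mod int n = (p' + a) mod int n" for a
    by (metis mod_add_left_eq)
  ultimately show ?thesis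
    by (simp add: z)
qed

lemma cycle_edges_6:
  "cycle_edges [a, b, c, d, e, f] = {{a, b}, {b, c}, {c, d}, {d, e}, {e, f}, {f, a}}"
proof -
  have "{..<6} = {0, 1, 2, 3, 4, 5 :: nat}"
    by auto
  moreover have "length [a, b, c, d, e, f] = 6"
    by simp
  ultimately have "cycle_edges [a, b, c, d, e, f] =
    (\<lambda>j. {[a, b, c, d, e, f] ! j, [a, b, c, d, e, f] ! ((j + 1) mod 6)}) ` {0, 1, 2, 3, 4, 5}"
    by (simp only: cycle_edges_def)
  then show ?thesis
    by simp
qed

lemma length_6_conv: "length xs = 6 \<longleftrightarrow> (\<exists>a b c d e f. xs = [a, b, c, d, e, f])"
proof
  assume "length xs = 6"
  then have "xs = [xs ! 0, xs ! 1, xs ! 2, xs ! 3, xs ! 4, xs ! 5]"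
    using map_nth[of xs] by (simp add: upt_conv_Cons eval_nat_numeral)
  then show "\<exists>a b c d e f. xs = [a, b, c, d, e, f]"
    by blast
qed auto

lemma cycle_edges_of_walk:
  assumes w: "hexagon_walk n z ss" and n: "n > 0"
  shows "cycle_edges (map (proj n) (walk_ends z ss)) = edge n ` set (walk_names n z ss)"
proof -
  obtain a b c d e f where ss: "ss = [a, b, c, d, e, f]"
    using w by (auto simp: hexagon_walk_def length_6_conv)
  have "{a, b, c, d, e, f} \<subseteq> {-1, 0, 1}"
    and "proj n (move (move (move (move (move (move z a) b) c) d) e) f) = proj n z"
    using w by (auto simp: hexagon_walk_def ss)
  with n show ?thesis
    by (simp add: ss cycle_edges_6 edge_move_name del: move.simps proj.simps move_name.simps)
qed

lemma hexagon_walk_imp_hexagon: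
  assumes w: "hexagon_walk n z ss" and n: "n > 0"
  shows "set (walk_names n z ss) \<in> hexagons n"
proof -
  let ?xs = "map (proj n) (walk_ends z ss)"
  have names: "set (walk_names n z ss) \<subseteq> set (names n)"
    using move_name_in_names[OF n] by (induction ss arbitrary: z) (auto simp del: move_name.simps)
  have "proj n y \<in> verts (gen_petersen n 2)" for y
    using n by (cases y) (auto simp: gen_petersen_def nat_less_iff)
  then have "set ?xs \<subseteq> verts (gen_petersen n 2)"
    by auto
  moreover have "length ?xs = 6"
    using w by (auto simp: hexagon_walk_def length_6_conv)
  moreover have "distinct ?xs"
    using w by (simp add: hexagon_walk_def)
  moreover have "cycle_edges ?xs \<subseteq> edges (gen_petersen n 2)"
    using names cycle_edges_of_walk[OF w n] by (auto simp: edges_gen_petersen)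
  ultimately have "cycle_in (gen_petersen n 2) ?xs"
    by (simp add: cycle_in_def)
  with names \<open>length ?xs = 6\<close> cycle_edges_of_walk[OF w n] show ?thesis
    by (auto simp only: hexagons_def mem_Collect_eq)
qed

text \<open>Start at any vertex of the hexagon and choose a move for each of its edges in turn. The initial
  position can be taken in \<open>{0..<n}\<close>, which leaves finitely many candidates for a given \<open>n\<close>.\<close>

lemma hexagon_imp_hexagon_walk:
  assumes E: "E \<in> hexagons n" and n: "n \<ge> 5"
  obtains t p ss where "hexagon_walk n (t, p) ss" "0 \<le> p" "p < int n"
    "E = set (walk_names n (t, p) ss)"
proof -
  obtain xs where xs: "length xs = 6" "cycle_in (gen_petersen n 2) xs" "cycle_edges xs = edge n ` E"
    and sub: "E \<subseteq> set (names n)"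
    using E by (auto simp: hexagons_def)
  obtain x0 x1 x2 x3 x4 x5 where xs_eq: "xs = [x0, x1, x2, x3, x4, x5]"
    using xs by (auto simp: length_6_conv)
  have pos: "n > 0"
    using n by simp
  have adj: "{x0, x1} \<in> edges (gen_petersen n 2)" "{x1, x2} \<in> edges (gen_petersen n 2)"
    "{x2, x3} \<in> edges (gen_petersen n 2)" "{x3, x4} \<in> edges (gen_petersen n 2)"
    "{x4, x5} \<in> edges (gen_petersen n 2)" "{x5, x0} \<in> edges (gen_petersen n 2)"
    using xs by (auto simp: cycle_in_def xs_eq cycle_edges_6)
  have "x0 \<in> verts (gen_petersen n 2)"
    using xs by (auto simp: cycle_in_def xs_eq)
  then obtain i where i: "i < n" "x0 = U i \<or> x0 = V i"
    by (auto simp: gen_petersen_def)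
  define t where "t \<longleftrightarrow> x0 = U i"
  define p where "p = int i"
  have x0: "x0 = proj n (t, p)" "0 \<le> p" "p < int n"
    using i by (auto simp: t_def p_def)
  obtain a where a: "a \<in> {-1, 0, 1}" "x1 = proj n (move (t, p) a)"
    using neighbour_is_move[OF pos adj(1)[unfolded x0]] .
  obtain b where b: "b \<in> {-1, 0, 1}" "x2 = proj n (move (move (t, p) a) b)"
    using neighbour_is_move[OF pos adj(2)[unfolded a]] .
  obtain c where c: "c \<in> {-1, 0, 1}" "x3 = proj n (move (move (move (t, p) a) b) c)"
    using neighbour_is_move[OF pos adj(3)[unfolded b]] .
  obtain d where d: "d \<in> {-1, 0, 1}" "x4 = proj n (move (move (move (move (t, p) a) b) c) d)"
    using neighbour_is_move[OF pos adj(4)[unfolded c]] .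
  obtain e where e: "e \<in> {-1, 0, 1}"
    "x5 = proj n (move (move (move (move (move (t, p) a) b) c) d) e)"
    using neighbour_is_move[OF pos adj(5)[unfolded d]] .
  obtain f where f: "f \<in> {-1, 0, 1}"
    "x0 = proj n (move (move (move (move (move (move (t, p) a) b) c) d) e) f)"
    using neighbour_is_move[OF pos adj(6)[unfolded e]] .
  let ?ss = "[a, b, c, d, e, f]"
  have map: "map (proj n) (walk_ends (t, p) ?ss) = xs"
    using x0 a b c d e by (simp add: xs_eq del: move.simps proj.simps)
  then have w: "hexagon_walk n (t, p) ?ss"
    using x0 a b c d e f xs
    by (simp add: hexagon_walk_def cycle_in_def del: move.simps proj.simps)
  have "set (walk_names n (t, p) ?ss) \<subseteq> set (names n)"
    using hexagon_walk_imp_hexagon[OF w pos] by (auto simp: hexagons_def)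
  moreover have "edge n ` E = edge n ` set (walk_names n (t, p) ?ss)"
    using cycle_edges_of_walk[OF w pos] map xs by simp
  ultimately have "E = set (walk_names n (t, p) ?ss)"
    using inj_on_image_eq_iff[OF inj_on_edge[OF n]] sub by blast
  with that w x0 show thesis
    by blast
qed

section \<open>The displacement of a hexagon\<close>

text \<open>These are the words of six moves without backtracking, read cyclically: in particular the first
  move does not undo the last one.\<close>

definition reduced_words :: "int list list" where
  "reduced_words = filter (\<lambda>ss. list_all2 (\<lambda>s s'. s' \<noteq> - s) ss (rotate1 ss)) (List.n_lists 6 [-1, 0, 1])"

lemma hexagon_walk_reduced:
  assumes w: "hexagon_walk n z ss" and n: "n > 0"
  shows "ss \<in> set reduced_words"
proof -
  obtain a b c d e f where ss: "ss = [a, b, c, d, e, f]"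
    using w by (auto simp: hexagon_walk_def length_6_conv)
  have s: "a \<in> {-1, 0, 1}" "b \<in> {-1, 0, 1}" "c \<in> {-1, 0, 1}" "d \<in> {-1, 0, 1}" "e \<in> {-1, 0, 1}"
    "f \<in> {-1, 0, 1}"
    and closed: "proj n (move (move (move (move (move (move z a) b) c) d) e) f) = proj n z"
    and dist: "distinct (map (proj n) (walk_ends z ss))"
    using w by (auto simp: hexagon_walk_def ss)
  have "b \<noteq> - a"
    using dist move_back[OF s(1), of z] by (auto simp: ss simp del: move.simps proj.simps)
  moreover have "c \<noteq> - b"
    using dist move_back[OF s(2), of "move z a"] by (auto simp: ss simp del: move.simps proj.simps)
  moreover have "d \<noteq> - c"
    using dist move_back[OF s(3), of "move (move z a) b"]
    by (auto simp: ss simp del: move.simps proj.simps)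
  moreover have "e \<noteq> - d"
    using dist move_back[OF s(4), of "move (move (move z a) b) c"]
    by (auto simp: ss simp del: move.simps proj.simps)
  moreover have "f \<noteq> - e"
    using dist closed move_back[OF s(5), of "move (move (move (move z a) b) c) d"]
    by (auto simp: ss simp del: move.simps proj.simps)
  \<comment> \<open>The final state lies over the initial one, so moving on by \<open>a\<close> leads to the second vertex;
    if \<open>a\<close> undid the last move, this would be the last vertex.\<close>
  moreover have "a \<noteq> - f"
  proof
    assume a: "a = - f"
    have "proj n (move z a) = proj n (move (move (move (move (move z a) b) c) d) e)"
      using proj_move_cong[OF closed n, of a] move_back[OF s(6)] a by simp
    with dist show False
      by (simp add: ss del: move.simps proj.simps)
  qed
  ultimately show ?thesis
    using s w by (simp add: reduced_words_def ss set_n_lists)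
qed

text \<open>Between spokes a reduced word keeps its direction. So the displacement of a word that
  returns to its side is \<open>\<plusminus>6\<close> or \<open>\<plusminus>12\<close> without spokes, and \<open>\<plusminus>1 \<plusminus> 6\<close>, \<open>\<plusminus>2 \<plusminus> 4\<close> or
  \<open>\<plusminus>3 \<plusminus> 2\<close> with two spokes.\<close>

lemma displacement:
  assumes "ss \<in> set reduced_words" "fst (foldl move (t, 0) ss) = t"
  shows "\<bar>snd (foldl move (t, 0) ss)\<bar> \<in> {1, 2, 5, 6, 7, 12}"
proof -
  have "\<forall>t\<in>{True, False}. \<forall>ss\<in>set reduced_words. fst (foldl move (t, 0) ss) = t \<longrightarrow>
    \<bar>snd (foldl move (t, 0) ss)\<bar> \<in> {1, 2, 5, 6, 7, 12}"
    by code_simp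
  with assms show ?thesis
    by (cases t) auto
qed

lemma foldl_move_shift: "foldl move (t, p + q) ss = map_prod id (\<lambda>x. p + x) (foldl move (t, q) ss)"
proof (induction ss arbitrary: t q)
  case (Cons s ss)
  then show ?case
    by (simp add: add.assoc)
qed simp

text \<open>A hexagon closes up modulo \<open>n\<close>, so \<open>n\<close> divides its displacement; but no divisor of a possible
  displacement is at least 5, other than 5, 6, 7 and 12.\<close>

lemma no_hexagons:
  assumes "n \<ge> 5" "n \<notin> {5, 6, 7, 12}"
  shows "hexagons n = {}"
proof (rule ccontr)
  assume "hexagons n \<noteq> {}"
  then obtain E where "E \<in> hexagons n"
    by blast
  then obtain t p ss where w: "hexagon_walk n (t, p) ss"
    using hexagon_imp_hexagon_walk assms(1) by metis
  obtain t' q where end0: "foldl move (t, 0) ss = (t', q)"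
    by (cases "foldl move (t, 0) ss")
  then have "foldl move (t, p) ss = (t', p + q)"
    using foldl_move_shift[of t p 0 ss] by simp
  then have *: "proj n (t', p + q) = proj n (t, p)"
    using w by (simp add: hexagon_walk_def del: proj.simps)
  then have "t' = t" and eq: "(p + q) mod int n = p mod int n"
    using assms by (auto simp: eq_nat_nat_iff split: if_splits)
  have "int n dvd q"
    using mod_eq_dvd_iff[THEN iffD1, OF eq] by simp
  define d where "d = nat \<bar>q\<bar>"
  have "n dvd d"
    using \<open>int n dvd q\<close> by (simp add: d_def flip: int_dvd_int_iff)
  moreover have "d \<in> {1, 2, 5, 6, 7, 12}"
    using displacement[of ss t] hexagon_walk_reduced[OF w] assms end0 \<open>t' = t\<close>
    by (auto simp: d_def)
  ultimately have dvd: "n dvd 1 \<or> n dvd 2 \<or> n dvd 5 \<or> n dvd 6 \<or> n dvd 7 \<or> n dvd 12"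
    by blast
  then have "n \<le> 12"
    by (auto dest: dvd_imp_le)
  then have "n \<in> {8, 9, 10, 11}"
    using assms by auto
  with dvd show False
    by auto
qed

section \<open>The hexagons in the exceptional cases\<close>

text \<open>One walk for each hexagon. The outer and inner moves add up to the displacement \<open>3 + 2\<close> or
  \<open>1 - 6\<close> for \<open>n = 5\<close>, to \<open>2 + 4\<close> or \<open>6\<close> (the outer cycle) for \<open>n = 6\<close>, to \<open>1 + 6\<close> for \<open>n = 7\<close>, and to
  \<open>12\<close> (an inner cycle) for \<open>n = 12\<close>, the only other value of interest.\<close>

definition hexagon_codes :: "nat \<Rightarrow> ((bool \<times> int) \<times> int list) list" where
  "hexagon_codes n =
    (if n = 5 then
       map (\<lambda>i. ((True, i), [1, 1, 1, 0, 1, 0])) [0..4] @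
       map (\<lambda>i. ((True, i), [1, 0, -1, -1, -1, 0])) [0..4]
     else if n = 6 then
       map (\<lambda>i. ((True, i), [1, 1, 0, 1, 1, 0])) [0..5] @ [((True, 0), [1, 1, 1, 1, 1, 1])]
     else if n = 7 then
       map (\<lambda>i. ((True, i), [1, 0, 1, 1, 1, 0])) [0..6]
     else
       map (\<lambda>i. ((False, i), [1, 1, 1, 1, 1, 1])) [0..1])"

definition hexagon_list :: "nat \<Rightarrow> edge_name list list" where
  "hexagon_list n = map (\<lambda>(z, ss). walk_names n z ss) (hexagon_codes n)"

text \<open>For a numeral \<open>n\<close> the premises can be evaluated. In the last one the quantifier over words comes
  first, so that the words are enumerated only once.\<close>

lemma hexagons_eqI:
  assumes n: "n \<ge> 5"
    and walks: "\<forall>(z, ss)\<in>set (hexagon_codes n). hexagon_walk n z ss"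
    and complete: "\<forall>ss\<in>set reduced_words. \<forall>t\<in>set [True, False]. \<forall>p\<in>set [0..int n - 1].
      hexagon_walk n (t, p) ss \<longrightarrow> (\<exists>h\<in>set (hexagon_list n). set (walk_names n (t, p) ss) = set h)"
  shows "hexagons n = set ` set (hexagon_list n)"
proof (intro equalityI subsetI)
  fix E assume "E \<in> hexagons n"
  then obtain t p ss where w: "hexagon_walk n (t, p) ss" "0 \<le> p" "p < int n"
    "E = set (walk_names n (t, p) ss)"
    using hexagon_imp_hexagon_walk n by metis
  have "ss \<in> set reduced_words"
    using hexagon_walk_reduced w n by simp
  then have "\<exists>h\<in>set (hexagon_list n). set (walk_names n (t, p) ss) = set h"
    using complete[rule_format, of ss t p] w by auto
  then show "E \<in> set ` set (hexagon_list n)"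
    using w by blast
next
  fix E assume "E \<in> set ` set (hexagon_list n)"
  then show "E \<in> hexagons n"
    using walks n by (auto simp: hexagon_list_def intro!: hexagon_walk_imp_hexagon)
qed

lemma hexagons_5: "hexagons 5 = set ` set (hexagon_list 5)"
  by (rule hexagons_eqI, simp, code_simp, code_simp)

lemma hexagons_6: "hexagons 6 = set ` set (hexagon_list 6)"
  by (rule hexagons_eqI, simp, code_simp, code_simp)

lemma hexagons_7: "hexagons 7 = set ` set (hexagon_list 7)"
  by (rule hexagons_eqI, simp, code_simp, code_simp)

lemma hexagons_12: "hexagons 12 = set ` set (hexagon_list 12)"
  by (rule hexagons_eqI, simp, code_simp, code_simp)

section \<open>Colours lost by repetitions\<close>

text \<open>The set \<open>cov x\<close> collects the members of the family in which the colour \<open>x\<close> is repeated, and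
  \<open>m x\<close> is the size of the colour class; the number of lost colours is the sum of all \<open>m x - 1\<close>. A
  class of size at most 2 covers at most \<open>2 (m x - 1)\<close> members by the bound on common members, and any
  class covers at most \<open>m x * D / 2\<close> by counting incidences. If the loss is at most 3, at most one
  class is larger than 2, and the members covered are too few in each case.\<close>

lemma colour_loss_at_least_4:
  fixes E :: "'i \<Rightarrow> 'e set"
  assumes fin: "finite S" "finite I"
    and sub: "\<And>i. i \<in> I \<Longrightarrow> E i \<subseteq> S"
    and deg: "\<And>e. e \<in> S \<Longrightarrow> card {i \<in> I. e \<in> E i} \<le> D"
    and codeg: "\<And>e f. e \<in> S \<Longrightarrow> f \<in> S \<Longrightarrow> e \<noteq> f \<Longrightarrow> card {i \<in> I. e \<in> E i \<and> f \<in> E i} \<le> 2"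
    and D: "3 \<le> D" "2 * D < card I"
    and rep: "\<And>i. i \<in> I \<Longrightarrow> \<not> inj_on \<kappa> (E i)"
  shows "card (\<kappa> ` S) + 4 \<le> card S"
proof (rule ccontr)
  assume few: "\<not> card (\<kappa> ` S) + 4 \<le> card S"
  define K where "K x = {e \<in> S. \<kappa> e = x}" for x
  define m where "m x = card (K x)" for x
  define cov where "cov x = {i \<in> I. \<exists>e\<in>E i \<inter> K x. \<exists>f\<in>E i \<inter> K x. e \<noteq> f}" for x
  have finK: "finite (K x)" for x
    using fin by (simp add: K_def)
  have fincov: "finite (cov x)" for x
    using fin by (simp add: cov_def)
  have pos: "m x \<ge> 1" if "x \<in> \<kappa> ` S" for x
  proof -
    have "K x \<noteq> {}"
      using that by (auto simp: K_def)
    then show ?thesis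
      using finK by (simp add: m_def Suc_le_eq card_gt_0_iff)
  qed
  have loss: "(\<Sum>x\<in>\<kappa> ` S. m x - 1) \<le> 3"
  proof -
    have "card S = (\<Sum>x\<in>\<kappa> ` S. m x)"
      using fin sum.image_gen[of S "\<lambda>_. 1 :: nat" \<kappa>] by (simp add: m_def K_def)
    also have "\<dots> = (\<Sum>x\<in>\<kappa> ` S. (m x - 1) + 1)"
      by (rule sum.cong) (use pos in fastforce)+
    also have "\<dots> = (\<Sum>x\<in>\<kappa> ` S. m x - 1) + card (\<kappa> ` S)"
      unfolding sum.distrib by simp
    finally show ?thesis
      using few by simp
  qed
  have cover: "card I \<le> (\<Sum>x\<in>\<kappa> ` S. card (cov x))"
  proof -
    have "I \<subseteq> (\<Union>x\<in>\<kappa> ` S. cov x)"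
    proof
      fix i assume i: "i \<in> I"
      then obtain e f where "e \<in> E i" "f \<in> E i" "\<kappa> e = \<kappa> f" "e \<noteq> f"
        using rep[OF i] by (auto simp: inj_on_def)
      moreover from this have "e \<in> S" "f \<in> S"
        using sub i by auto
      ultimately show "i \<in> (\<Union>x\<in>\<kappa> ` S. cov x)"
        using i by (auto simp: cov_def K_def)
    qed
    then have "card I \<le> card (\<Union>x\<in>\<kappa> ` S. cov x)"
      using fin fincov by (intro card_mono) auto
    also have "\<dots> \<le> (\<Sum>x\<in>\<kappa> ` S. card (cov x))"
      using fin by (intro card_UN_le) auto
    finally show ?thesis .
  qed
  have double_count: "2 * card (cov x) \<le> D * m x" for x
  proof -
    have two: "2 \<le> card (E i \<inter> K x)" if "i \<in> cov x" for i
    proof -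
      obtain e f where ef: "e \<in> E i \<inter> K x" "f \<in> E i \<inter> K x" "e \<noteq> f"
        using \<open>i \<in> cov x\<close> by (auto simp: cov_def)
      then have "card {e, f} \<le> card (E i \<inter> K x)"
        using finK by (intro card_mono) auto
      with ef show ?thesis
        by simp
    qed
    have "2 * card (cov x) = (\<Sum>i\<in>cov x. 2)"
      by simp
    also have "\<dots> \<le> (\<Sum>i\<in>cov x. card (E i \<inter> K x))"
      using two by (intro sum_mono)
    also have "\<dots> \<le> (\<Sum>i\<in>I. card (E i \<inter> K x))"
      using fin by (intro sum_mono2) (auto simp: cov_def)
    also have "\<dots> = (\<Sum>i\<in>I. \<Sum>e\<in>K x. of_bool (e \<in> E i))"
      using finK by (intro sum.cong) (simp_all add: Int_commute)
    also have "\<dots> = (\<Sum>e\<in>K x. \<Sum>i\<in>I. of_bool (e \<in> E i))"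
      by (rule sum.swap)
    also have "\<dots> = (\<Sum>e\<in>K x. card {i \<in> I. e \<in> E i})"
      using fin by (intro sum.cong) (simp_all add: Int_def)
    also have "\<dots> \<le> (\<Sum>e\<in>K x. D)"
      using deg by (intro sum_mono) (auto simp: K_def)
    also have "\<dots> = D * m x"
      by (simp add: m_def)
    finally show ?thesis .
  qed
  have small: "card (cov x) \<le> 2 * (m x - 1)" if x: "x \<in> \<kappa> ` S" "m x \<le> 2" for x
  proof -
    consider "m x = 1" | "m x = 2"
      using pos[of x] x by linarith
    then show ?thesis
    proof cases
      case 1
      then obtain e where "K x = {e}"
        by (auto simp: m_def card_1_singleton_iff)
      then have "cov x = {}"
        by (auto simp: cov_def)
      then show ?thesis
        by simp
    next
      case 2
      then obtain e f where ef: "K x = {e, f}" "e \<noteq> f"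
        by (auto simp: m_def card_2_iff)
      have "card (cov x) \<le> card {i \<in> I. e \<in> E i \<and> f \<in> E i}"
        using fin ef by (intro card_mono) (auto simp: cov_def)
      also have "\<dots> \<le> 2"
        using ef by (intro codeg) (auto simp: K_def)
      finally show ?thesis
        using 2 by simp
    qed
  qed
  show False
  proof (cases "\<forall>x\<in>\<kappa> ` S. m x \<le> 2")
    case True
    then have "(\<Sum>x\<in>\<kappa> ` S. card (cov x)) \<le> (\<Sum>x\<in>\<kappa> ` S. 2 * (m x - 1))"
      using small by (intro sum_mono) auto
    then show False
      using cover loss D by (simp flip: sum_distrib_left)
  next
    case False
    then obtain x0 where x0: "x0 \<in> \<kappa> ` S" "m x0 \<ge> 3"
      by force
    let ?R = "\<kappa> ` S - {x0}"
    have rest: "(m x0 - 1) + (\<Sum>x\<in>?R. m x - 1) \<le> 3"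
      using loss fin x0 by (simp add: sum.remove)
    have "m x - 1 \<le> (\<Sum>x\<in>?R. m x - 1)" if "x \<in> ?R" for x
      using that fin by (intro member_le_sum) auto
    \<comment> \<open>The large class already loses two of the three colours.\<close>
    then have "m x \<le> 2" if "x \<in> ?R" for x
      using that rest x0 by fastforce
    then have "(\<Sum>x\<in>?R. card (cov x)) \<le> (\<Sum>x\<in>?R. 2 * (m x - 1))"
      using small by (intro sum_mono) auto
    moreover have "(\<Sum>x\<in>\<kappa> ` S. card (cov x)) = card (cov x0) + (\<Sum>x\<in>?R. card (cov x))"
      using fin x0 by (simp add: sum.remove)
    ultimately have bound: "card I \<le> card (cov x0) + 2 * (4 - m x0)"
      using cover rest x0 by (simp flip: sum_distrib_left)
    consider "m x0 = 3" | "m x0 = 4"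
      using rest x0 by linarith
    then show False
    proof cases
      case 1
      then have "card I \<le> card (cov x0) + 2" "2 * card (cov x0) \<le> D * 3"
        using bound double_count[of x0] by simp_all
      then show False
        using D by linarith
    next
      case 2
      then have "card I \<le> card (cov x0)" "2 * card (cov x0) \<le> D * 4"
        using bound double_count[of x0] by simp_all
      then show False
        using D by linarith
    qed
  qed
qed

text \<open>One edge of each repetition can be deleted without losing a colour, since disjointness keeps
  its partner in place.\<close>

lemma colour_loss_at_least_2:
  assumes fin: "finite S" and sub: "A \<subseteq> S" "B \<subseteq> S" and disj: "A \<inter> B = {}"
    and rep: "\<not> inj_on \<kappa> A" "\<not> inj_on \<kappa> B"
  shows "card (\<kappa> ` S) + 2 \<le> card S"
proof -
  obtain a a' where a: "a \<in> A" "a' \<in> A" "a \<noteq> a'" "\<kappa> a = \<kappa> a'"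
    using rep by (auto simp: inj_on_def)
  obtain b b' where b: "b \<in> B" "b' \<in> B" "b \<noteq> b'" "\<kappa> b = \<kappa> b'"
    using rep by (auto simp: inj_on_def)
  have "a \<noteq> b"
    using a b disj by blast
  have "{a', b'} \<subseteq> S - {a, b}"
    using a b sub disj by auto
  then have "\<kappa> ` {a, b} \<subseteq> \<kappa> ` (S - {a, b})"
    using a b by auto
  then have "\<kappa> ` S = \<kappa> ` (S - {a, b})"
    by auto
  then have "card (\<kappa> ` S) \<le> card (S - {a, b})"
    using fin by (simp add: card_image_le)
  moreover have "{a, b} \<subseteq> S" "card {a, b} = 2"
    using a b sub \<open>a \<noteq> b\<close> by auto
  then have "card (S - {a, b}) = card S - 2" "2 \<le> card S"
    using fin card_mono[of S "{a, b}"] by (simp_all add: card_Diff_subset)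
  ultimately show ?thesis
    by simp
qed

section \<open>The exceptional anti-Ramsey numbers\<close>

text \<open>Why these colourings work:
  \<^item> \<open>n = 5\<close>: every hexagon uses two spokes.
  \<^item> \<open>n = 6\<close>: the hexagon through \<open>u\<^sub>i, u\<^sub>i\<^sub>+\<^sub>1, u\<^sub>i\<^sub>+\<^sub>2, v\<^sub>i\<^sub>+\<^sub>2, v\<^sub>i\<^sub>+\<^sub>4, v\<^sub>i\<close> has two of \<open>b\<^sub>1, b\<^sub>3, b\<^sub>5\<close> if \<open>i\<close> is odd, both
    \<open>a\<^sub>0\<close> and \<open>a\<^sub>1\<close> if \<open>i = 0\<close>, and both \<open>s\<^sub>4\<close> and \<open>b\<^sub>0\<close> if \<open>i\<close> is 2 or 4. The outer cycle has \<open>a\<^sub>0\<close> and \<open>a\<^sub>1\<close>.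
  \<^item> \<open>n = 7\<close>: every hexagon has three inner edges \<open>b\<^sub>i\<^sub>+\<^sub>1, b\<^sub>i\<^sub>+\<^sub>3, b\<^sub>i\<^sub>+\<^sub>5\<close>, and at most one of these is \<open>b\<^sub>0\<close> or
    \<open>b\<^sub>1\<close>.
  \<^item> \<open>n = 12\<close>: the inner edges of even index form one hexagon, those of odd index the other; each has one pair.\<close>

definition colouring :: "nat \<Rightarrow> edge_name \<Rightarrow> edge_name" where
  "colouring n e =
    (if n = 5 then (if e \<in> set (map Spoke [0..<5]) then Spoke 0 else e)
     else if n = 6 then
       (if e \<in> {Inner 3, Inner 5} then Inner 1
        else if e = Outer 1 then Outer 0
        else if e = Spoke 4 then Inner 0
        else e)
     else if n = 7 then (if e \<in> set (map Inner [2..<7]) then Inner 2 else e)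
     else (if e = Inner 2 then Inner 0 else if e = Inner 3 then Inner 1 else e))"

lemma colouring_repeats:
  assumes "\<forall>h\<in>set (hexagon_list n). distinct h \<and> \<not> distinct (map (colouring n) h)"
    and "E \<in> set ` set (hexagon_list n)"
  shows "\<not> inj_on (colouring n) E"
  using assms by (auto simp: distinct_map)

text \<open>This form of the double count serves \<open>n = 5, 6, 7\<close>: with the hexagons listed, what remains is
  decided by evaluation.\<close>

lemma anti_ramsey_by_counting:
  assumes n: "n \<ge> 5"
    and hex: "hexagons n = set ` set (hexagon_list n)"
    and repeats: "\<forall>h\<in>set (hexagon_list n). distinct h \<and> \<not> distinct (map (colouring n) h)"
    and colours: "card (set (map (colouring n) (names n))) = 3 * n - 4"
    and deg: "\<forall>e\<in>set (names n). length (filter (\<lambda>h. e \<in> set h) (hexagon_list n)) \<le> D"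
    and codeg: "\<forall>e\<in>set (names n). \<forall>f\<in>set (names n). e \<noteq> f \<longrightarrow>
      length (filter (\<lambda>h. e \<in> set h \<and> f \<in> set h) (hexagon_list n)) \<le> 2"
    and D: "3 \<le> D" "2 * D < card (set (hexagon_list n))"
  shows "anti_ramsey (gen_petersen n 2) (cycle_graph 6) = 3 * n - 4"
proof (rule anti_ramsey_hexagon_eqI[OF n, where r = "colouring n"])
  show "\<not> inj_on (colouring n) E" if "E \<in> hexagons n" for E
    using that colouring_repeats[OF repeats] by (simp add: hex)
  show "card (colouring n ` set (names n)) = 3 * n - 4"
    using colours by simp
  fix \<kappa> :: "edge_name \<Rightarrow> nat"
  assume rep: "\<And>E. E \<in> hexagons n \<Longrightarrow> \<not> inj_on \<kappa> E"
  have "card (\<kappa> ` set (names n)) + 4 \<le> card (set (names n))"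
  proof (rule colour_loss_at_least_4[where I = "set (hexagon_list n)" and E = set and D = D])
    have "E \<subseteq> set (names n)" if "E \<in> hexagons n" for E
      using that by (auto simp: hexagons_def)
    then show "set h \<subseteq> set (names n)" if "h \<in> set (hexagon_list n)" for h
      using that hex by blast
    show "card {h \<in> set (hexagon_list n). e \<in> set h} \<le> D" if "e \<in> set (names n)" for e
      using deg that by (metis card_length le_trans set_filter)
    show "card {h \<in> set (hexagon_list n). e \<in> set h \<and> f \<in> set h} \<le> 2"
      if "e \<in> set (names n)" "f \<in> set (names n)" "e \<noteq> f" for e f
      using codeg that card_length[of "filter (\<lambda>h. e \<in> set h \<and> f \<in> set h) (hexagon_list n)"]
      by fastforce
  qed (use D rep hex in auto)
  then show "card (\<kappa> ` set (names n)) \<le> 3 * n - 4"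
    by (simp add: card_names)
qed

lemma anti_ramsey_5: "anti_ramsey (gen_petersen 5 2) (cycle_graph 6) = 11"
proof -
  have "anti_ramsey (gen_petersen 5 2) (cycle_graph 6) = 3 * 5 - 4"
    by (rule anti_ramsey_by_counting[OF _ hexagons_5, where D = 4], simp) code_simp+
  then show ?thesis
    by simp
qed

lemma anti_ramsey_6: "anti_ramsey (gen_petersen 6 2) (cycle_graph 6) = 14"
proof -
  have "anti_ramsey (gen_petersen 6 2) (cycle_graph 6) = 3 * 6 - 4"
    by (rule anti_ramsey_by_counting[OF _ hexagons_6, where D = 3], simp) code_simp+
  then show ?thesis
    by simp
qed

lemma anti_ramsey_7: "anti_ramsey (gen_petersen 7 2) (cycle_graph 6) = 17"
proof -
  have "anti_ramsey (gen_petersen 7 2) (cycle_graph 6) = 3 * 7 - 4"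
    by (rule anti_ramsey_by_counting[OF _ hexagons_7, where D = 3], simp) code_simp+
  then show ?thesis
    by simp
qed

lemma anti_ramsey_12: "anti_ramsey (gen_petersen 12 2) (cycle_graph 6) = 34"
proof (rule anti_ramsey_hexagon_eqI[where r = "colouring 12"])
  have "\<forall>h\<in>set (hexagon_list 12). distinct h \<and> \<not> distinct (map (colouring 12) h)"
    by code_simp
  then show "\<not> inj_on (colouring 12) E" if "E \<in> hexagons 12" for E
    using that colouring_repeats by (simp add: hexagons_12)
  have "card (set (map (colouring 12) (names 12))) = 34"
    by code_simp
  then show "card (colouring 12 ` set (names 12)) = 34"
    by simp
  fix \<kappa> :: "edge_name \<Rightarrow> nat"
  assume rep: "\<And>E. E \<in> hexagons 12 \<Longrightarrow> \<not> inj_on \<kappa> E"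
  let ?A = "set (hexagon_list 12 ! 0)" and ?B = "set (hexagon_list 12 ! 1)"
  have "length (hexagon_list 12) = 2" "?A \<inter> ?B = {}"
    by code_simp+
  then have "?A \<in> hexagons 12" "?B \<in> hexagons 12"
    by (simp_all add: hexagons_12)
  then have "card (\<kappa> ` set (names 12)) + 2 \<le> card (set (names 12))"
    using rep \<open>?A \<inter> ?B = {}\<close> by (intro colour_loss_at_least_2) (auto simp: hexagons_def)
  then show "card (\<kappa> ` set (names 12)) \<le> 34"
    by (simp add: card_names)
qed simp

theorem theorem1p4:
  fixes n :: nat
  assumes "n \<ge> 5"
  shows "anti_ramsey (gen_petersen n 2) (cycle_graph 6) =
    (if n = 5 then 11
     else if n = 6 then 14
     else if n = 7 then 17
     else if n = 12 then 34
     else 3 * n)"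
proof (cases "n \<in> {5, 6, 7, 12}")
  case True
  then show ?thesis
    using anti_ramsey_5 anti_ramsey_6 anti_ramsey_7 anti_ramsey_12 by auto
next
  case False
  then have none: "hexagons n = {}"
    using assms by (intro no_hexagons)
  have "anti_ramsey (gen_petersen n 2) (cycle_graph 6) = 3 * n"
  proof (rule anti_ramsey_hexagon_eqI[where r = id])
    fix \<kappa> :: "edge_name \<Rightarrow> nat"
    show "card (\<kappa> ` set (names n)) \<le> 3 * n"
      using card_image_le[of "set (names n)" \<kappa>] by (simp add: card_names)
  qed (use assms none in \<open>simp_all add: card_names\<close>)
  with False show ?thesis
    by auto
qed

end
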